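(* Let $\mathfrak{g}=\mathfrak{g}_{2.1}\oplus 2\mathfrak{g}_1$ be the four-dimensional real Lie algebra with basis $\mathcal{B}=\{e_1,e_2,e_3,e_4\}$ whose only nonzero Lie bracket (up to skew-symmetry) is $[e_1,e_2]=e_1$. Let $\langle\cdot,\cdot\rangle$ be a pseudo-Riemannian inner product on $\mathfrak{g}$ and let $(R_{ij})$ be the matrix of its Ricci operator $\operatorname{Ric}$ in the basis $\mathcal{B}$. If $$R_{21}=R_{31}=R_{41}=R_{13}=R_{14}=R_{23}=R_{24}=0,$$ then $\langle\cdot,\cdot\rangle$ is an algebraic Ricci soliton. In this situation, $\operatorname{Ric}=\eta I_4+D$ where $\eta=R_{22}$ and $$D=\begin{bmatrix}R_{11}-R_{22}&R_{12}&0&0\\0&0&0&0\\0&R_{32}&R_{33}-R_{22}&R_{34}\\0&R_{42}&R_{43}&R_{44}-R_{22}\end{bmatrix}$$ is (the matrix in the basis $\mathcal{B}$ of) a derivation of $\mathfrak{g}$.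
   Context: A pseudo-Riemannian inner product on a real Lie algebra $\mathfrak{g}$ is a nondegenerate symmetric bilinear form $\langle\cdot,\cdot\rangle$ on $\mathfrak{g}$ (of some signature $(r,s)$). Its Levi-Civita connection $\nabla$ is defined by $2\langle\nabla_uv,w\rangle=\langle[u,v],w\rangle+\langle[w,u],v\rangle+\langle[w,v],u\rangle$; its curvature is $R_{uv}=\nabla_{[u,v]}-[\nabla_u,\nabla_v]$; its Ricci curvature $\operatorname{ric}(u,v)$ is the trace of $w\mapsto R_{uw}v$; its Ricci operator $\operatorname{Ric}$ is the endomorphism of $\mathfrak{g}$ with $\langle\operatorname{Ric}(u),v\rangle=\operatorname{ric}(u,v)$. The matrix $(R_{ij})$ of $\operatorname{Ric}$ in a basis $\{e_i\}$ is given by $\operatorname{Ric}(e_j)=\sum_iR_{ij}e_i$ (the same column convention is used for $D$). A derivation is a linear map $D:\mathfrak{g}\to\mathfrak{g}$ with $D[x,y]=[D(x),y]+[x,D(y)]$ for all $x,y$. The inner product is an algebraic Ricci soliton if $\operatorname{Ric}=\eta\,\mathrm{Id}_{\mathfrak{g}}+D$ for some $\eta\in\mathbb{R}$ and some derivation $D$ of $\mathfrak{g}$. *)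

theory Defs
  imports "HOL-Analysis.Analysis"
begin

section \<open>Bases, matrices and traces of endomorphisms\<close>

definition basis_family :: "('n::finite \<Rightarrow> 'a::real_vector) \<Rightarrow> bool" where
  "basis_family e \<longleftrightarrow> inj e \<and> independent (range e) \<and> span (range e) = UNIV"

text \<open>Column convention: \<open>f (e j) = (\<Sum>i. matrix_in_basis e f $ i $ j *\<^sub>R e i)\<close>.\<close>

definition matrix_in_basis ::
    "('n::finite \<Rightarrow> 'a::real_vector) \<Rightarrow> ('a \<Rightarrow> 'a) \<Rightarrow> real ^ 'n ^ 'n" where
  "matrix_in_basis e f = (\<chi> i j. representation (range e) (f (e j)) (e i))"

text \<open>The trace is computed in an unspecified basis of the (finite-dimensional) space; the lemma
  \<open>endo_trace_eq\<close> below shows that the choice does not matter.\<close>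

definition endo_trace :: "('a::real_vector \<Rightarrow> 'a) \<Rightarrow> real" where
  "endo_trace f = (\<Sum>b\<in>extend_basis {}. representation (extend_basis {}) (f b) b)"

section \<open>Lie algebras with a pseudo-Riemannian inner product\<close>

definition lie_algebra :: "('a::real_vector \<Rightarrow> 'a \<Rightarrow> 'a) \<Rightarrow> bool" where
  "lie_algebra br \<longleftrightarrow> bilinear br \<and> (\<forall>x. br x x = 0) \<and>
     (\<forall>x y z. br x (br y z) + br y (br z x) + br z (br x y) = 0)"

definition derivation :: "('a::real_vector \<Rightarrow> 'a \<Rightarrow> 'a) \<Rightarrow> ('a \<Rightarrow> 'a) \<Rightarrow> bool" where
  "derivation br D \<longleftrightarrow> linear D \<and> (\<forall>x y. D (br x y) = br (D x) y + br x (D y))"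

definition pseudo_inner_product :: "('a::real_vector \<Rightarrow> 'a \<Rightarrow> real) \<Rightarrow> bool" where
  "pseudo_inner_product ip \<longleftrightarrow> bilinear ip \<and> (\<forall>x y. ip x y = ip y x) \<and>
     (\<forall>x. (\<forall>y. ip x y = 0) \<longrightarrow> x = 0)"

text \<open>In finite dimension, the descriptions in \<open>levi_civita\<close> and \<open>ricci_operator\<close> are well defined by
  nondegeneracy; see \<open>levi_civita_eq\<close> and \<open>ricci_operator_eq\<close> below.\<close>

definition levi_civita ::
    "('a::real_vector \<Rightarrow> 'a \<Rightarrow> 'a) \<Rightarrow> ('a \<Rightarrow> 'a \<Rightarrow> real) \<Rightarrow> 'a \<Rightarrow> 'a \<Rightarrow> 'a" where
  "levi_civita br ip u v =
     (THE x. \<forall>w. 2 * ip x w = ip (br u v) w + ip (br w u) v + ip (br w v) u)"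

text \<open>Sign convention: \<open>R\<^bsub>uv\<^esub> = \<nabla>\<^bsub>[u,v]\<^esub> - [\<nabla>\<^bsub>u\<^esub>, \<nabla>\<^bsub>v\<^esub>]\<close>.\<close>

definition curvature ::
    "('a::real_vector \<Rightarrow> 'a \<Rightarrow> 'a) \<Rightarrow> ('a \<Rightarrow> 'a \<Rightarrow> real) \<Rightarrow> 'a \<Rightarrow> 'a \<Rightarrow> 'a \<Rightarrow> 'a" where
  "curvature br ip u v x = levi_civita br ip (br u v) x -
     (levi_civita br ip u (levi_civita br ip v x) - levi_civita br ip v (levi_civita br ip u x))"

definition ricci ::
    "('a::real_vector \<Rightarrow> 'a \<Rightarrow> 'a) \<Rightarrow> ('a \<Rightarrow> 'a \<Rightarrow> real) \<Rightarrow> 'a \<Rightarrow> 'a \<Rightarrow> real" where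
  "ricci br ip u v = endo_trace (\<lambda>w. curvature br ip u w v)"

definition ricci_operator ::
    "('a::real_vector \<Rightarrow> 'a \<Rightarrow> 'a) \<Rightarrow> ('a \<Rightarrow> 'a \<Rightarrow> real) \<Rightarrow> 'a \<Rightarrow> 'a" where
  "ricci_operator br ip u = (THE x. \<forall>v. ip x v = ricci br ip u v)"

definition algebraic_ricci_soliton ::
    "('a::real_vector \<Rightarrow> 'a \<Rightarrow> 'a) \<Rightarrow> ('a \<Rightarrow> 'a \<Rightarrow> real) \<Rightarrow> bool" where
  "algebraic_ricci_soliton br ip \<longleftrightarrow>
     (\<exists>\<eta> D. derivation br D \<and> (\<forall>x. ricci_operator br ip x = \<eta> *\<^sub>R x + D x))"

section \<open>Well-definedness\<close>

lemma basis_family_finite_basis: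
  assumes "basis_family e"
  shows "finite (range e)" "independent (range e)" "span (range e) = UNIV"
  using assms by (simp_all add: basis_family_def)

lemma basis_trace_eq:
  fixes f :: "'a::real_vector \<Rightarrow> 'a"
  assumes f: "linear f"
    and B: "finite B" "independent B" "span B = UNIV"
    and C: "finite C" "independent C" "span C = UNIV"
  shows "(\<Sum>b\<in>B. representation B (f b) b) = (\<Sum>c\<in>C. representation C (f c) c)"
proof -
  have lB: "linear (\<lambda>v. representation B v b)" for b
    using real_vector.linear_representation[OF B(2,3)]
    by (simp add: linear_def real_scaleR_def[abs_def])
  have lC: "linear (\<lambda>v. representation C v c)" for c
    using real_vector.linear_representation[OF C(2,3)]
    by (simp add: linear_def real_scaleR_def[abs_def])
  have sB: "(\<Sum>b\<in>B. representation B v b *\<^sub>R b) = v" for v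
    using B by (intro real_vector.sum_representation_eq) auto
  have sC: "(\<Sum>c\<in>C. representation C v c *\<^sub>R c) = v" for v
    using C by (intro real_vector.sum_representation_eq) auto
  have "representation B (f b) b = (\<Sum>c\<in>C. representation C b c * representation B (f c) b)" for b
  proof -
    have "f b = (\<Sum>c\<in>C. representation C b c *\<^sub>R f c)"
      using sC[of b] f by (metis (mono_tags, lifting) linear_cmul linear_sum sum.cong)
    then show ?thesis
      by (simp add: linear_sum[OF lB] linear_cmul[OF lB])
  qed
  then have "(\<Sum>b\<in>B. representation B (f b) b)
      = (\<Sum>c\<in>C. \<Sum>b\<in>B. representation C b c * representation B (f c) b)"
    by (simp add: sum.swap[of _ B C])
  also have "\<dots> = (\<Sum>c\<in>C. representation C (\<Sum>b\<in>B. representation B (f c) b *\<^sub>R b) c)"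
    by (simp add: linear_sum[OF lC] linear_cmul[OF lC] mult.commute)
  finally show ?thesis
    by (simp add: sB)
qed

lemma endo_trace_eq:
  fixes e :: "'n::finite \<Rightarrow> 'a::real_vector"
  assumes e: "basis_family e" and f: "linear f"
  shows "endo_trace f = trace (matrix_in_basis e f)"
proof -
  let ?B = "extend_basis {} :: 'a set"
  have B: "independent ?B" "span ?B = UNIV"
    by (simp_all add: real_vector.independent_extend_basis real_vector.independent_empty)
  have fin: "finite ?B"
    using real_vector.independent_span_bound[of "range e" ?B] B(1) e
    by (auto simp: basis_family_def)
  show ?thesis
    unfolding endo_trace_def basis_trace_eq[OF f fin B basis_family_finite_basis[OF e]]
      matrix_in_basis_def trace_def
    using e by (simp add: basis_family_def sum.reindex)
qed

lemma riesz_pseudo: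
  fixes e :: "'n::finite \<Rightarrow> 'a::real_vector"
    and ip :: "'a \<Rightarrow> 'a \<Rightarrow> real"
  assumes e: "basis_family e" and ip: "pseudo_inner_product ip" and l: "linear l"
  shows "\<exists>!x. \<forall>v. ip x v = l v"
proof -
  note C = basis_family_finite_basis[OF e]
  have bi: "bilinear ip" and nd: "\<And>x. (\<forall>y. ip x y = 0) \<Longrightarrow> x = 0"
    using ip by (auto simp: pseudo_inner_product_def)
  have lin1: "linear (\<lambda>x. ip x y)" and lin2: "linear (ip x)" for x y
    using bi by (auto simp: bilinear_def)
  define T where "T x = (\<chi> i. ip x (e i))" for x
  define S where "S c = (\<Sum>i\<in>UNIV. (c $ i) *\<^sub>R e i)" for c :: "real ^ 'n"
  have linT: "linear T"
    by (rule linearI) (simp_all add: T_def vec_eq_iff linear_add[OF lin1] linear_cmul[OF lin1])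
  have linS: "linear S"
    by (rule linearI) (simp_all add: S_def scaleR_add_left sum.distrib scaleR_sum_right)
  have ext: "f = g" if "linear f" "linear g" "\<And>i. f (e i) = g (e i)" for f g :: "'a \<Rightarrow> real"
  proof
    fix x
    show "f x = g x"
      by (rule linear_eq_on[OF that(1,2), of x "range e"]) (use C that in auto)
  qed
  have "inj S"
  proof (rule linear_injective_0[THEN iffD2, OF linS], intro allI impI)
    fix c assume "S c = 0"
    then have "(\<Sum>v\<in>range e. (c $ inv e v) *\<^sub>R v) = 0"
      using e by (simp add: basis_family_def sum.reindex S_def)
    then have "\<forall>v\<in>range e. c $ inv e v = 0"
      using C(1,2) by (auto simp: dependent_finite)
    then show "c = 0"
      using e by (simp add: basis_family_def vec_eq_iff)
  qed
  moreover have "inj T"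
  proof (rule linear_injective_0[THEN iffD2, OF linT], intro allI impI)
    fix x assume "T x = 0"
    then have "ip x (e i) = 0" for i by (simp add: T_def vec_eq_iff)
    then have "ip x = (\<lambda>_. 0)"
      by (intro ext lin2) (auto simp: linear_zero)
    then show "x = 0" using nd by metis
  qed
  ultimately have "inj (T \<circ> S)" "linear (T \<circ> S)"
    using linS linT by (auto simp: inj_compose linear_compose)
  then have "surj (T \<circ> S)"
    by (intro linear_injective_imp_surjective) simp_all
  then obtain c where "T (S c) = (\<chi> i. l (e i))"
    by (metis comp_apply surjD)
  then have "ip (S c) = l"
    by (intro ext lin2 l) (simp add: T_def vec_eq_iff)
  moreover have "x = y" if "\<forall>v. ip x v = l v" "\<forall>v. ip y v = l v" for x y
    using nd[of "x - y"] that by (simp add: linear_diff[OF lin1])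
  ultimately show ?thesis by metis
qed

lemma levi_civita_eq:
  fixes e :: "'n::finite \<Rightarrow> 'a::real_vector"
    and br :: "'a \<Rightarrow> 'a \<Rightarrow> 'a" and ip :: "'a \<Rightarrow> 'a \<Rightarrow> real"
  assumes e: "basis_family e" and ip: "pseudo_inner_product ip" and br: "lie_algebra br"
  shows "2 * ip (levi_civita br ip u v) w = ip (br u v) w + ip (br w u) v + ip (br w v) u"
proof -
  have bi: "bilinear ip" and bb: "bilinear br"
    using ip br by (auto simp: pseudo_inner_product_def lie_algebra_def)
  have "linear (\<lambda>w. (ip (br u v) w + ip (br w u) v + ip (br w v) u) / 2)"
    by (rule linearI)
      (simp_all add: bilinear_ladd[OF bi] bilinear_radd[OF bi] bilinear_lmul[OF bi]
        bilinear_rmul[OF bi] bilinear_ladd[OF bb] bilinear_lmul[OF bb] field_simps)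
  from riesz_pseudo[OF e ip this]
  have "\<exists>!x. \<forall>w. 2 * ip x w = ip (br u v) w + ip (br w u) v + ip (br w v) u"
    by (simp add: field_simps)
  from theI'[OF this] show ?thesis
    by (simp add: levi_civita_def)
qed

lemma bilinear_levi_civita:
  fixes e :: "'n::finite \<Rightarrow> 'a::real_vector"
    and br :: "'a \<Rightarrow> 'a \<Rightarrow> 'a" and ip :: "'a \<Rightarrow> 'a \<Rightarrow> real"
  assumes e: "basis_family e" and ip: "pseudo_inner_product ip" and br: "lie_algebra br"
  shows "bilinear (levi_civita br ip)"
proof -
  note lc = levi_civita_eq[OF e ip br]
  have bi: "bilinear ip" and bb: "bilinear br" and nd: "\<And>x. (\<forall>y. ip x y = 0) \<Longrightarrow> x = 0"
    using ip br by (auto simp: pseudo_inner_product_def lie_algebra_def)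
  have eqI: "x = y" if "\<And>w. 2 * ip x w = 2 * ip y w" for x y
    using nd[of "x - y"] that by (simp add: bilinear_lsub[OF bi])
  note bs = bilinear_ladd[OF bi] bilinear_radd[OF bi] bilinear_lmul[OF bi] bilinear_rmul[OF bi]
    bilinear_ladd[OF bb] bilinear_radd[OF bb] bilinear_lmul[OF bb] bilinear_rmul[OF bb]
  show ?thesis
    unfolding bilinear_def
  proof (intro conjI allI linearI; rule eqI)
    fix u v v' w
    show "2 * ip (levi_civita br ip u (v + v')) w
        = 2 * ip (levi_civita br ip u v + levi_civita br ip u v') w"
      by (simp add: bs distrib_left lc)
    show "2 * ip (levi_civita br ip (v + v') u) w
        = 2 * ip (levi_civita br ip v u + levi_civita br ip v' u) w"
      by (simp add: bs distrib_left lc)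
  next
    fix u v w and c :: real
    have *: "2 * (c * x) = c * (2 * x)" for x :: real by simp
    show "2 * ip (levi_civita br ip u (c *\<^sub>R v)) w = 2 * ip (c *\<^sub>R levi_civita br ip u v) w"
      by (simp add: bs * lc del: mult.left_commute) (simp add: distrib_left)
    show "2 * ip (levi_civita br ip (c *\<^sub>R v) u) w = 2 * ip (c *\<^sub>R levi_civita br ip v u) w"
      by (simp add: bs * lc del: mult.left_commute) (simp add: distrib_left)
  qed
qed

lemma ricci_operator_eq:
  fixes e :: "'n::finite \<Rightarrow> 'a::real_vector"
    and br :: "'a \<Rightarrow> 'a \<Rightarrow> 'a" and ip :: "'a \<Rightarrow> 'a \<Rightarrow> real"
  assumes e: "basis_family e" and ip: "pseudo_inner_product ip" and br: "lie_algebra br"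
  shows "ip (ricci_operator br ip u) v = ricci br ip u v"
proof -
  have bl: "bilinear (levi_civita br ip)" and bb: "bilinear br"
    using bilinear_levi_civita[OF e ip br] br by (auto simp: lie_algebra_def)
  note bs = bilinear_ladd[OF bl] bilinear_radd[OF bl] bilinear_lmul[OF bl] bilinear_rmul[OF bl]
    bilinear_ladd[OF bb] bilinear_radd[OF bb] bilinear_lmul[OF bb] bilinear_rmul[OF bb]
  have lin: "linear (\<lambda>w. curvature br ip u w v)" for v
    by (rule linearI) (simp_all add: curvature_def bs algebra_simps)
  have rep: "linear (\<lambda>x. representation (range e) x b)" for b
    using real_vector.linear_representation[of "range e" b] e
    by (simp add: linear_def real_scaleR_def[abs_def] basis_family_def)
  have add: "curvature br ip u w (v + v') = curvature br ip u w v + curvature br ip u w v'"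
    and scale: "curvature br ip u w (c *\<^sub>R v) = c *\<^sub>R curvature br ip u w v" for w v v' c
    by (simp_all add: curvature_def bs algebra_simps)
  have "ricci br ip u v = (\<Sum>i\<in>UNIV. representation (range e) (curvature br ip u (e i) v) (e i))" for v
    by (simp add: ricci_def endo_trace_eq[OF e lin] trace_def matrix_in_basis_def)
  then have "linear (ricci br ip u)"
    by (intro linearI)
      (simp_all add: add scale linear_add[OF rep] linear_cmul[OF rep] sum.distrib sum_distrib_left)
  from theI'[OF riesz_pseudo[OF e ip this]] show ?thesis
    by (simp add: ricci_operator_def)
qed

end

theory Submission
  imports Defs
begin

text \<open>Take \<open>D = Ric - R\<^sub>2\<^sub>2 Id\<close>. The vanishing entries say that \<open>e\<^sub>1\<close> is an eigenvector of \<open>D\<close> and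
  that \<open>D\<close> preserves the centre \<open>span {e\<^sub>3, e\<^sub>4}\<close>; the choice \<open>\<eta> = R\<^sub>2\<^sub>2\<close> removes the
  \<open>e\<^sub>2\<close>-component of \<open>D e\<^sub>2\<close>. These three properties already make a linear map a derivation, so
  linearity is all that is needed about \<open>Ric\<close>, and no curvature has to be computed.\<close>

text \<open>\<open>endo_trace_eq\<close> requires a linear endomorphism; this lets the trace
  defining \<open>ricci\<close> be computed in the given basis instead of the unspecified
  one.\<close>

lemma linear_curvature_second_arg:
  fixes br :: "'a::real_vector \<Rightarrow> 'a \<Rightarrow> 'a"
  assumes "bilinear br" "bilinear (levi_civita br ip)"
  shows "linear (\<lambda>w. curvature br ip u w v)"
  using assms
  by (intro linearI)
    (simp_all add: curvature_def bilinear_ladd bilinear_radd bilinear_lmul bilinear_rmul algebra_simps)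

lemma matrix_in_basis_arith:
  fixes e :: "'n::finite \<Rightarrow> 'a::real_vector"
  assumes "basis_family e"
  shows "matrix_in_basis e (\<lambda>x. f x + g x) = matrix_in_basis e f + matrix_in_basis e g"
    and "matrix_in_basis e (\<lambda>x. c *\<^sub>R f x) = c *\<^sub>R matrix_in_basis e f"
    and "matrix_in_basis e (\<lambda>x. f x - g x) = matrix_in_basis e f - matrix_in_basis e g"
  using assms
  by (simp_all add: matrix_in_basis_def vec_eq_iff basis_family_def
      real_vector.representation_add real_vector.representation_diff real_vector.representation_scale)

lemma matrix_in_basis_ident:
  assumes "basis_family e"
  shows "matrix_in_basis e (\<lambda>x. x) = mat 1"
  using assms
  by (auto simp: matrix_in_basis_def vec_eq_iff mat_def basis_family_def
      real_vector.representation_basis inj_eq)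

lemma matrix_in_basis_column:
  fixes e :: "'n::finite \<Rightarrow> 'a::real_vector"
  assumes "basis_family e"
  shows "f (e j) = (\<Sum>i\<in>UNIV. matrix_in_basis e f $ i $ j *\<^sub>R e i)"
proof -
  have "f (e j) = (\<Sum>b\<in>range e. representation (range e) (f (e j)) b *\<^sub>R b)"
    using assms by (intro real_vector.sum_representation_eq[symmetric]) (auto simp: basis_family_def)
  then show ?thesis
    using assms by (simp add: basis_family_def sum.reindex matrix_in_basis_def)
qed

lemma vector_4:
  "(vector [a, b, c, d] :: 'b::zero ^ 4) $ 1 = a"
  "(vector [a, b, c, d] :: 'b::zero ^ 4) $ 2 = b"
  "(vector [a, b, c, d] :: 'b::zero ^ 4) $ 3 = c"
  "(vector [a, b, c, d] :: 'b::zero ^ 4) $ 4 = d"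
  by (simp_all add: vector_def)

text \<open>By nondegeneracy, equalities of vectors may be tested after pairing with an arbitrary
  \<open>v\<close>. The claim then becomes linearity of \<open>ricci\<close> in its first argument,
  inherited from the curvature because the trace in a fixed basis is a sum of linear
  entries.\<close>

lemma linear_ricci_operator:
  fixes e :: "'n::finite \<Rightarrow> 'a::real_vector"
    and br :: "'a \<Rightarrow> 'a \<Rightarrow> 'a" and ip :: "'a \<Rightarrow> 'a \<Rightarrow> real"
  assumes e: "basis_family e" and ip: "pseudo_inner_product ip" and br: "lie_algebra br"
  shows "linear (ricci_operator br ip)"
proof -
  have bb: "bilinear br" and bi: "bilinear ip"
    and nd: "\<And>x. (\<forall>y. ip x y = 0) \<Longrightarrow> x = 0"
    using br ip by (auto simp: lie_algebra_def pseudo_inner_product_def)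
  note bl = bilinear_levi_civita[OF e ip br]
  note bs = bilinear_ladd[OF bl] bilinear_radd[OF bl] bilinear_lmul[OF bl] bilinear_rmul[OF bl]
    bilinear_ladd[OF bb] bilinear_radd[OF bb] bilinear_lmul[OF bb] bilinear_rmul[OF bb]
  note ric = ricci_operator_eq[OF e ip br]
  have tr: "ricci br ip u v = trace (matrix_in_basis e (\<lambda>w. curvature br ip u w v))" for u v
    by (simp add: ricci_def endo_trace_eq[OF e linear_curvature_second_arg[OF bb bl]])
  have add: "curvature br ip (u + u') w v = curvature br ip u w v + curvature br ip u' w v"
    and scale: "curvature br ip (c *\<^sub>R u) w v = c *\<^sub>R curvature br ip u w v" for u u' w v c
    by (simp_all add: curvature_def bs algebra_simps)
  have eqI: "x = y" if "\<And>v. ip x v = ip y v" for x y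
    using nd[of "x - y"] that by (simp add: bilinear_lsub[OF bi])
  show ?thesis
    by (intro linearI; rule eqI)
      (simp_all add: bilinear_ladd[OF bi] bilinear_lmul[OF bi] ric tr add scale
        matrix_in_basis_arith[OF e] trace_def sum.distrib sum_distrib_left)
qed

text \<open>Both sides of the Leibniz rule are bilinear in \<open>x\<close> and \<open>y\<close>, so
  agreement on pairs of basis vectors propagates to all pairs.\<close>

lemma derivation_on_basis:
  fixes e :: "'n::finite \<Rightarrow> 'a::real_vector"
  assumes e: "basis_family e" and br: "bilinear br" and D: "linear D"
    and eq: "\<And>i j. D (br (e i) (e j)) = br (D (e i)) (e j) + br (e i) (D (e j))"
  shows "derivation br D"
proof -
  note bs = bilinear_ladd[OF br] bilinear_radd[OF br] bilinear_lmul[OF br] bilinear_rmul[OF br]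
  have l: "bilinear (\<lambda>x y. D (br x y))"
    and r: "bilinear (\<lambda>x y. br (D x) y + br x (D y))"
    by (auto simp: bilinear_def bs linear_add[OF D] linear_cmul[OF D] algebra_simps intro!: linearI)
  have "D (br x y) = br (D x) y + br x (D y)" for x y
    by (rule bilinear_eq[OF l r, of UNIV "range e" UNIV "range e"])
      (use e eq in \<open>auto simp: basis_family_def\<close>)
  with D show ?thesis by (simp add: derivation_def)
qed

theorem theorem3p1:
  fixes br :: "'a::real_vector \<Rightarrow> 'a \<Rightarrow> 'a"
    and ip :: "'a \<Rightarrow> 'a \<Rightarrow> real"
    and e :: "4 \<Rightarrow> 'a"
    and R :: "real ^ 4 ^ 4"
  assumes "lie_algebra br"
    and "basis_family e"
    and "br (e 1) (e 2) = e 1"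
    and "\<And>i j. {i, j} \<noteq> {1, 2} \<Longrightarrow> br (e i) (e j) = 0"
    and "pseudo_inner_product ip"
    and R: "R = matrix_in_basis e (ricci_operator br ip)"
    and "R $ 2 $ 1 = 0" "R $ 3 $ 1 = 0" "R $ 4 $ 1 = 0" "R $ 1 $ 3 = 0"
      "R $ 1 $ 4 = 0" "R $ 2 $ 3 = 0" "R $ 2 $ 4 = 0"
  shows "algebraic_ricci_soliton br ip \<and>
    (\<exists>D. matrix_in_basis e D = vector
           [vector [R $ 1 $ 1 - R $ 2 $ 2, R $ 1 $ 2, 0, 0],
            vector [0, 0, 0, 0],
            vector [0, R $ 3 $ 2, R $ 3 $ 3 - R $ 2 $ 2, R $ 3 $ 4],
            vector [0, R $ 4 $ 2, R $ 4 $ 3, R $ 4 $ 4 - R $ 2 $ 2]]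
       \<and> derivation br D
       \<and> (\<forall>x. ricci_operator br ip x = (R $ 2 $ 2) *\<^sub>R x + D x))"
proof -
  note br = assms(1) and e = assms(2) and e12 = assms(3) and zero = assms(4) and ip = assms(5)
  have bb: "bilinear br" and alt: "br x x = 0" for x
    using br by (auto simp: lie_algebra_def)
  note bs = bilinear_ladd[OF bb] bilinear_radd[OF bb] bilinear_lmul[OF bb] bilinear_rmul[OF bb]
    bilinear_lzero[OF bb] bilinear_rzero[OF bb]
  \<comment> \<open>Polarization: the left side vanishes by alternation. The pair (2,1) has to be
    treated separately because \<open>{2, 1} = {1, 2}\<close> is excluded from
    \<open>zero\<close>.\<close>
  have "br (e 1 + e 2) (e 1 + e 2) = br (e 2) (e 1) + e 1"
    by (simp add: bs alt[of "e 1"] alt[of "e 2"] e12)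
  then have e21: "br (e 2) (e 1) = - e 1"
    by (metis alt eq_neg_iff_add_eq_0)
  define D where "D x = ricci_operator br ip x - R $ 2 $ 2 *\<^sub>R x" for x
  have ric: "ricci_operator br ip x = R $ 2 $ 2 *\<^sub>R x + D x" for x
    by (simp add: D_def)
  have linD: "linear D"
    using linear_ricci_operator[OF e ip br] unfolding D_def[abs_def]
    by (intro linear_compose_sub linear_scaleR)
  have "matrix_in_basis e D = R - R $ 2 $ 2 *\<^sub>R mat 1"
    by (simp add: D_def[abs_def] matrix_in_basis_arith[OF e] matrix_in_basis_ident[OF e] R)
  \<comment> \<open>The seven vanishing hypotheses supply every off-diagonal zero, and the (2,2)
    entry cancels.\<close>
  also have "\<dots> = vector
           [vector [R $ 1 $ 1 - R $ 2 $ 2, R $ 1 $ 2, 0, 0],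
            vector [0, 0, 0, 0],
            vector [0, R $ 3 $ 2, R $ 3 $ 3 - R $ 2 $ 2, R $ 3 $ 4],
            vector [0, R $ 4 $ 2, R $ 4 $ 3, R $ 4 $ 4 - R $ 2 $ 2]]"
    using assms(7-13) by (simp add: vec_eq_iff forall_4 mat_def vector_4)
  finally have M: "matrix_in_basis e D = \<dots>" .
  have cols: "D (e 1) = (R $ 1 $ 1 - R $ 2 $ 2) *\<^sub>R e 1"
    "D (e 2) = R $ 1 $ 2 *\<^sub>R e 1 + R $ 3 $ 2 *\<^sub>R e 3 + R $ 4 $ 2 *\<^sub>R e 4"
    "D (e 3) = (R $ 3 $ 3 - R $ 2 $ 2) *\<^sub>R e 3 + R $ 4 $ 3 *\<^sub>R e 4"
    "D (e 4) = R $ 3 $ 4 *\<^sub>R e 3 + (R $ 4 $ 4 - R $ 2 $ 2) *\<^sub>R e 4"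
    by (simp_all add: matrix_in_basis_column[OF e, of D] M sum_4 vector_4)
  \<comment> \<open>With \<open>e12\<close>, \<open>e21\<close> and \<open>alt\<close> on the
    diagonal, these ten values complete the table of sixteen brackets.\<close>
  have zeros: "br (e 1) (e 3) = 0" "br (e 1) (e 4) = 0" "br (e 2) (e 3) = 0" "br (e 2) (e 4) = 0"
    "br (e 3) (e 1) = 0" "br (e 3) (e 2) = 0" "br (e 3) (e 4) = 0"
    "br (e 4) (e 1) = 0" "br (e 4) (e 2) = 0" "br (e 4) (e 3) = 0"
    by (rule zero; auto simp: doubleton_eq_iff)+
  \<comment> \<open>For the pair (1,2), both sides equal \<open>D (e 1)\<close>, since
    \<open>D (e 2)\<close> has no \<open>e 2\<close> component and so commutes with
    \<open>e 1\<close>. For (2,2), the two terms on the right are opposite multiples of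
    \<open>e 1\<close>. Pairs involving \<open>e 3\<close> or \<open>e 4\<close> give zero because
    \<open>D\<close> keeps these vectors central.\<close>
  have "\<forall>i j. D (br (e i) (e j)) = br (D (e i)) (e j) + br (e i) (D (e j))"
    by (simp add: forall_4 zeros e12 e21 alt cols bs linear_0[OF linD] linear_neg[OF linD])
  then have "derivation br D"
    by (intro derivation_on_basis[OF e bb linD]) blast
  with M ric show ?thesis
    unfolding algebraic_ricci_soliton_def by blast
qed

end
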